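(* Let $m\ge 1$ be an integer and suppose $f\in C^m_{\mathrm{cl}}(-1,1)$. For every integer $W\ge 1$ there exist complex coefficients $\hat f_1,\dots,\hat f_N\in\mathbb{C}$ and real frequencies $\omega_1,\dots,\omega_N\in\mathbb{R}$, where $N=W+2(m+1)$, such that the approximation $$F_W(x)=\sum_{k=1}^{N}\hat f_k\,e^{i\omega_k x}$$ satisfies the error bound $$\|f-F_W\|_{L^2(-1,1)}\le C_m W^{-m+1/2}$$ for some constant $C_m>0$. Moreover, $|\hat f_k|\le D_m$ for all $k$. Both constants $C_m$ and $D_m$ depend on $f$ and $m$, but not on $W$. The frequencies $\{\omega_k\}$ are independent of $f$ (i.e. for given $m$ and $W$ the same frequencies can be used for all $f\in C^m_{\mathrm{cl}}(-1,1)$).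
   Context: For an integer $m\ge 0$ and an open interval $(a,b)$, $C^m_{\mathrm{cl}}(a,b)$ denotes the set of real-valued functions $f\in C^m(a,b)$ ($m$ times continuously differentiable on the open interval) such that all derivatives $f^{(k)}$, $0\le k\le m$, have well-defined finite one-sided limits at $x=a$ and at $x=b$. *)

theory Defs
  imports "HOL-Analysis.Analysis"
begin

(* The k-th derivative is the iterate deriv ^^ k. As (a, b) is open, its values on (a, b) depend
   only on the values of f there; nothing is required of f outside (a, b). *)
definition C_cl :: "nat \<Rightarrow> real \<Rightarrow> real \<Rightarrow> (real \<Rightarrow> real) set" where
  "C_cl m a b = {f.
     (\<forall>k<m. (deriv ^^ k) f differentiable_on {a<..<b}) \<and>
     (\<forall>k\<le>m. continuous_on {a<..<b} ((deriv ^^ k) f)) \<and>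
     (\<forall>k\<le>m. (\<exists>l. ((deriv ^^ k) f \<longlongrightarrow> l) (at_right a)) \<and>
             (\<exists>l. ((deriv ^^ k) f \<longlongrightarrow> l) (at_left b)))}"

(* Meaningful only for square-integrable g, since a non-integrable function has Bochner
   integral 0. The lemma below discharges this for differences of an element of C_cl and a
   continuous function. *)
definition L2_norm_on :: "real \<Rightarrow> real \<Rightarrow> (real \<Rightarrow> complex) \<Rightarrow> real" where
  "L2_norm_on a b g = sqrt (LINT x:{a<..<b}|lborel. (cmod (g x))\<^sup>2)"

definition exp_sum :: "nat \<Rightarrow> (nat \<Rightarrow> complex) \<Rightarrow> (nat \<Rightarrow> real) \<Rightarrow> real \<Rightarrow> complex" where
  "exp_sum N c \<omega> x = (\<Sum>k=1..N. c k * exp (\<i> * complex_of_real (\<omega> k * x)))"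

lemma continuous_on_exp_sum: "continuous_on S (exp_sum N c \<omega>)"
  unfolding exp_sum_def by (intro continuous_intros)

lemma C_cl_diff_square_integrable:
  assumes f: "f \<in> C_cl m a b" and ab: "a < b" and F: "continuous_on {a..b} F"
  shows "set_integrable lborel {a<..<b} (\<lambda>x. (cmod (complex_of_real (f x) - F x))\<^sup>2)"
proof -
  have cont: "continuous_on {a<..<b} f"
    and "\<exists>l. (f \<longlongrightarrow> l) (at_right a)" "\<exists>l. (f \<longlongrightarrow> l) (at_left b)"
    using f unfolding C_cl_def by (force dest: spec[where x = 0])+
  then obtain l r where l: "(f \<longlongrightarrow> l) (at_right a)" and r: "(f \<longlongrightarrow> r) (at_left b)"
    by blast
  define g where "g = (\<lambda>x. if x = a then l else if x = b then r else f x)"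
  have "continuous_on {a..b} g"
  proof (rule continuous_on_IccI)
    have "eventually (\<lambda>x. g x = f x) (at_right a)"
      using eventually_at_right_less[of a] eventually_at_right_real[OF ab]
      by eventually_elim (auto simp: g_def)
    then show "(g \<longlongrightarrow> g a) (at_right a)"
      using l by (simp add: g_def tendsto_cong)
    have "eventually (\<lambda>x. g x = f x) (at_left b)"
      using eventually_at_left_real[OF ab] by eventually_elim (auto simp: g_def)
    then show "(g \<longlongrightarrow> g b) (at_left b)"
      using r ab by (simp add: g_def tendsto_cong)
    fix x assume x: "a < x" "x < b"
    have "eventually (\<lambda>y. y \<in> {a<..<b}) (at x)"
      using x by (intro eventually_at_in_open') auto
    then have "eventually (\<lambda>y. g y = f y) (at x)"
      by eventually_elim (auto simp: g_def)
    moreover have "f \<midarrow>x\<rightarrow> f x"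
      using cont x by (auto simp: continuous_on_eq_continuous_at isCont_def)
    ultimately show "g \<midarrow>x\<rightarrow> g x"
      using x by (simp add: g_def tendsto_cong)
  qed (rule ab)
  then have "continuous_on {a..b} (\<lambda>x. (cmod (complex_of_real (g x) - F x))\<^sup>2)"
    by (intro continuous_intros F)
  then have "set_integrable lborel {a..b} (\<lambda>x. (cmod (complex_of_real (g x) - F x))\<^sup>2)"
    by (rule borel_integrable_atLeastAtMost')
  then have "set_integrable lborel {a<..<b} (\<lambda>x. (cmod (complex_of_real (g x) - F x))\<^sup>2)"
    by (rule set_integrable_subset) auto
  then show ?thesis
    by (subst set_integrable_cong[OF refl refl]) (auto simp: g_def)
qed

end

theory Submission
  imports Defs
begin

text \<open>
  A Fourier series of period 2 converges slowly on \<open>(-1, 1)\<close> only because \<open>f\<close> and its derivatives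
  need not take equal values at the two ends. These jumps are finitely many numbers, so they can
  be removed by finitely many additional exponentials with frequencies outside \<open>\<pi>\<int>\<close>: the
  frequencies \<open>1 / j\<close>, \<open>1 \<le> j \<le> m\<close>, suffice for the jumps of the derivatives of order below \<open>m\<close>.
  Their amplitudes solve a Vandermonde system that depends on \<open>f\<close> and \<open>m\<close> but not on \<open>W\<close>
  (\<open>C_cl_periodic_decomposition\<close>).

  The remainder \<open>h\<close> is approximated by its Fourier partial sum over \<open>\<bar>k\<bar> \<le> n\<close>, where \<open>n\<close> is about
  \<open>W / 2\<close>. Since the boundary terms cancel, \<open>m\<close> integrations by parts express the coefficients of
  \<open>h\<close> as those of the \<open>m\<close>-th derivative divided by \<open>(\<i> \<pi> k)\<^sup>m\<close>. By Bessel's inequality the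
  latter coefficients are square summable, so the Cauchy-Schwarz inequality bounds the absolute
  tail of the series by a multiple of the square root of the sum of \<open>k\<close> to the power \<open>-2m\<close> over
  \<open>k > n\<close>, which is of order \<open>n\<close> to the power \<open>-m + 1/2\<close>. This holds uniformly on \<open>(-1, 1)\<close>
  (\<open>fourier_series_uniform_error\<close>), hence also in \<open>L\<^sup>2\<close>.

  That the series sums to \<open>h\<close> follows from an argument of Chernoff: dividing \<open>h - h x\<close> by \<open>e - e x\<close>, where \<open>e\<close> is the first harmonic,
  makes the partial sums at \<open>x\<close> telescope, up to Fourier coefficients of the quotient, which tend to
  zero (\<open>fourier_series_converges_pointwise\<close>).

  The amplitudes are bounded independently of \<open>W\<close>, since Fourier coefficients are bounded by the
  supremum of \<open>\<bar>h\<bar>\<close>.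
\<close>

section \<open>Fourier coefficients on the interval from -1 to 1\<close>

definition harmonic :: "int \<Rightarrow> real \<Rightarrow> complex" where
  "harmonic k x = cis (pi * of_int k * x)"

definition fourier_coeff :: "(real \<Rightarrow> complex) \<Rightarrow> int \<Rightarrow> complex" where
  "fourier_coeff g k = integral {-1..1} (\<lambda>x. g x * harmonic (- k) x) / 2"

lemma continuous_on_harmonic [continuous_intros]: "continuous_on S (harmonic k)"
  unfolding harmonic_def by (intro continuous_intros)

lemma harmonic_mult: "harmonic k x * harmonic l x = harmonic (k + l) x"
  by (simp add: harmonic_def cis_mult algebra_simps)

lemma harmonic_0 [simp]: "harmonic 0 x = 1"
  by (simp add: harmonic_def)

lemma cnj_harmonic [simp]: "cnj (harmonic k x) = harmonic (- k) x"
  by (simp add: harmonic_def cis_cnj)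

lemma norm_harmonic [simp]: "cmod (harmonic k x) = 1"
  by (simp add: harmonic_def)

lemma harmonic_periodic: "harmonic k 1 = harmonic k (-1)"
  by (simp add: harmonic_def complex_eq_iff sin_npi_int)

lemma exp_has_vector_derivative:
  "((\<lambda>x. exp (\<i> * complex_of_real (w * x))) has_vector_derivative
     \<i> * of_real w * exp (\<i> * complex_of_real (w * x))) (at x)"
proof -
  have "((\<lambda>z. exp (\<i> * (of_real w * z))) has_field_derivative
     \<i> * of_real w * exp (\<i> * (of_real w * of_real x))) (at (of_real x))"
    by (auto intro!: derivative_eq_intros)
  from has_vector_derivative_real_field[OF this] show ?thesis by simp
qed

lemma harmonic_has_vector_derivative:
  "(harmonic k has_vector_derivative \<i> * of_real (pi * of_int k) * harmonic k x) (at x)"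
  using exp_has_vector_derivative[of "pi * of_int k" x]
  unfolding harmonic_def cis_conv_exp by simp

lemma integral_harmonic: "integral {-1..1} (harmonic k) = (if k = 0 then 2 else 0)"
proof (cases "k = 0")
  case True
  moreover have "harmonic 0 = (\<lambda>_. 1)" by (simp add: fun_eq_iff)
  ultimately show ?thesis using True by (simp add: scaleR_conv_of_real)
next
  case False
  have "((\<lambda>x. \<i> * of_real (pi * of_int k) * harmonic k x) has_integral
          (harmonic k 1 - harmonic k (-1))) {-1..1}"
    by (rule fundamental_theorem_of_calculus_interior)
       (simp, intro continuous_intros, intro harmonic_has_vector_derivative)
  from integral_unique[OF this]
  have "\<i> * of_real (pi * of_int k) * integral {-1..1} (harmonic k) = 0"
    by (simp only: integral_mult_right harmonic_periodic diff_self)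
  then show ?thesis using False by simp
qed

lemma fourier_coeff_bound:
  assumes "continuous_on {-1..1} g" "\<And>x. x \<in> {-1..1} \<Longrightarrow> cmod (g x) \<le> B"
  shows "cmod (fourier_coeff g k) \<le> B"
proof -
  have "cmod (integral {-1..1} (\<lambda>x. g x * harmonic (- k) x)) \<le> B * (1 - (-1))"
    using assms by (intro integral_bound continuous_intros) (auto simp: norm_mult)
  then show ?thesis by (simp add: fourier_coeff_def norm_divide)
qed

text \<open>
  The right-hand side minus the left-hand side is half the integral of \<open>\<bar>g - P\<bar>\<^sup>2\<close>, where \<open>P\<close> is the
  orthogonal projection of \<open>g\<close> to the span of the harmonics in \<open>A\<close>: both cross terms and the square
  of \<open>P\<close> integrate to twice the sum of the squared coefficients.
\<close>

lemma bessel_inequality: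
  assumes g: "continuous_on {-1..1} g" and A: "finite A"
  shows "(\<Sum>k\<in>A. (cmod (fourier_coeff g k))\<^sup>2) \<le> integral {-1..1} (\<lambda>x. (cmod (g x))\<^sup>2) / 2"
proof -
  define c where "c = fourier_coeff g"
  define P where "P x = (\<Sum>k\<in>A. c k * harmonic k x)" for x
  define s where "s = (\<Sum>k\<in>A. (cmod (c k))\<^sup>2)"
  have P: "continuous_on {-1..1} P"
    unfolding P_def by (intro continuous_intros)
  note int = integrable_continuous_interval
  have gP: "integral {-1..1} (\<lambda>x. g x * cnj (P x)) = of_real (2 * s)"
  proof -
    have "integral {-1..1} (\<lambda>x. g x * cnj (P x))
        = integral {-1..1} (\<lambda>x. \<Sum>k\<in>A. cnj (c k) * (g x * harmonic (-k) x))"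
      by (simp add: P_def sum_distrib_left algebra_simps)
    also have "\<dots> = (\<Sum>k\<in>A. integral {-1..1} (\<lambda>x. cnj (c k) * (g x * harmonic (-k) x)))"
      using A by (intro integral_sum int continuous_intros g) auto
    also have "\<dots> = (\<Sum>k\<in>A. cnj (c k) * (2 * c k))"
      by (simp add: c_def fourier_coeff_def)
    also have "\<dots> = of_real (2 * s)"
      by (simp add: s_def sum_distrib_left complex_norm_square algebra_simps del: of_real_power)
    finally show ?thesis .
  qed
  have PP: "integral {-1..1} (\<lambda>x. P x * cnj (P x)) = of_real (2 * s)"
  proof -
    have split: "harmonic (k - l) x = harmonic k x * harmonic (-l) x" for k l x
      by (simp add: harmonic_mult)
    have "integral {-1..1} (\<lambda>x. P x * cnj (P x))
        = integral {-1..1} (\<lambda>x. \<Sum>k\<in>A. \<Sum>l\<in>A. c k * cnj (c l) * harmonic (k - l) x)"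
      by (simp add: P_def sum_product split mult_ac)
    also have "\<dots> = (\<Sum>k\<in>A. integral {-1..1} (\<lambda>x. \<Sum>l\<in>A. c k * cnj (c l) * harmonic (k - l) x))"
      using A by (intro integral_sum int continuous_intros) auto
    also have "\<dots> = (\<Sum>k\<in>A. \<Sum>l\<in>A. integral {-1..1} (\<lambda>x. c k * cnj (c l) * harmonic (k - l) x))"
      using A by (intro sum.cong integral_sum int continuous_intros) auto
    also have "\<dots> = (\<Sum>k\<in>A. \<Sum>l\<in>A. if k = l then c k * cnj (c l) * 2 else 0)"
      by (intro sum.cong) (auto simp: integral_harmonic)
    also have "\<dots> = of_real (2 * s)"
      using A by (simp add: sum.delta s_def sum_distrib_left complex_norm_square algebra_simps del: of_real_power)
    finally show ?thesis .
  qed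
  have "0 \<le> integral {-1..1} (\<lambda>x. (cmod (g x - P x))\<^sup>2)"
    by (intro integral_nonneg int continuous_intros g P) auto
  also have "\<dots> = integral {-1..1} (\<lambda>x. (cmod (g x))\<^sup>2 - 2 * Re (g x * cnj (P x)) + Re (P x * cnj (P x)))"
    by (intro integral_cong, simp only: cmod_power2) (simp add: power2_eq_square algebra_simps)
  also have "\<dots> = integral {-1..1} (\<lambda>x. (cmod (g x))\<^sup>2)
      - 2 * integral {-1..1} (\<lambda>x. Re (g x * cnj (P x))) + integral {-1..1} (\<lambda>x. Re (P x * cnj (P x)))"
    by (subst integral_add integral_diff; (intro int continuous_intros g P)?)+
      (simp only: integral_mult_right)
  also have "integral {-1..1} (\<lambda>x. Re (g x * cnj (P x))) = 2 * s"
    using integral_linear[OF int bounded_linear_Re, of "-1" 1 "\<lambda>x. g x * cnj (P x)"] gP g P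
    by (simp add: o_def continuous_intros)
  also have "integral {-1..1} (\<lambda>x. Re (P x * cnj (P x))) = 2 * s"
    using integral_linear[OF int bounded_linear_Re, of "-1" 1 "\<lambda>x. P x * cnj (P x)"] PP P
    by (simp add: o_def continuous_intros)
  finally show ?thesis by (simp add: s_def c_def)
qed

text \<open>
  This is the Riemann-Lebesgue lemma for continuous functions, as a consequence of Bessel's
  inequality. The sequence \<open>\<sigma>\<close> serves to treat both directions to infinity at once.
\<close>

lemma fourier_coeff_tendsto_0:
  fixes \<sigma> :: "nat \<Rightarrow> int"
  assumes g: "continuous_on {-1..1} g" and "inj \<sigma>"
  shows "(\<lambda>n. fourier_coeff g (\<sigma> n)) \<longlonglongrightarrow> 0"
proof -
  have "summable (\<lambda>n. (cmod (fourier_coeff g (\<sigma> n)))\<^sup>2)"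
  proof (rule summableI_nonneg_bounded)
    fix n
    show "(\<Sum>i<n. (cmod (fourier_coeff g (\<sigma> i)))\<^sup>2) \<le> integral {-1..1} (\<lambda>x. (cmod (g x))\<^sup>2) / 2"
      using bessel_inequality[OF g, of "\<sigma> ` {..<n}"] \<open>inj \<sigma>\<close>
      by (simp add: sum.reindex inj_on_subset[OF \<open>inj \<sigma>\<close>])
  qed auto
  then have "(\<lambda>n. (cmod (fourier_coeff g (\<sigma> n)))\<^sup>2) \<longlonglongrightarrow> 0"
    by (rule summable_LIMSEQ_zero)
  then have "(\<lambda>n. sqrt ((cmod (fourier_coeff g (\<sigma> n)))\<^sup>2)) \<longlonglongrightarrow> sqrt 0"
    by (rule tendsto_real_sqrt)
  then show ?thesis by (simp add: tendsto_norm_zero_iff)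
qed

lemma has_vector_derivative_quotient_tendsto:
  assumes "(f has_vector_derivative D) (at x)"
  shows "((\<lambda>t. (f t - f x) /\<^sub>R (t - x)) \<longlongrightarrow> D) (at x)"
proof -
  have "((\<lambda>y. (1 / norm (y - x)) *\<^sub>R (f y - (f x + (y - x) *\<^sub>R D))) \<longlongrightarrow> 0) (at x)"
    using assms unfolding has_vector_derivative_def has_derivative_at2 by blast
  then have "((\<lambda>y. norm ((1 / norm (y - x)) *\<^sub>R (f y - (f x + (y - x) *\<^sub>R D)))) \<longlongrightarrow> 0) (at x)"
    by (rule tendsto_norm_zero)
  also have "?this \<longleftrightarrow> ((\<lambda>t. norm ((f t - f x) /\<^sub>R (t - x) - D)) \<longlongrightarrow> 0) (at x)"
  proof (rule filterlim_cong[OF refl refl], unfold eventually_at_filter, rule always_eventually, intro allI impI)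
    fix t assume "t \<noteq> x"
    then have "(f t - f x) /\<^sub>R (t - x) - D = inverse (t - x) *\<^sub>R (f t - (f x + (t - x) *\<^sub>R D))"
      by (simp add: scaleR_right_diff_distrib scaleR_right_distrib)
    then show "norm ((1 / norm (t - x)) *\<^sub>R (f t - (f x + (t - x) *\<^sub>R D)))
        = norm ((f t - f x) /\<^sub>R (t - x) - D)"
      by (simp add: divide_inverse)
  qed
  finally show ?thesis
    by (simp add: tendsto_norm_zero_iff LIM_zero_cancel)
qed


section \<open>Pointwise convergence of Fourier series\<close>

text \<open>
  Chernoff's argument. Write \<open>h t = h x + q t * (e t - e x)\<close> with the first harmonic \<open>e\<close>. As \<open>h\<close> is
  differentiable at the interior point \<open>x\<close> and \<open>e\<close> takes the value \<open>e x\<close> nowhere else on the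
  closed interval, \<open>q\<close> is continuous. Multiplication by \<open>e\<close> shifts Fourier coefficients by one, so
  that the \<open>k\<close>-th term of the series is a difference of consecutive terms built from the
  coefficients of \<open>q\<close>, apart from the contribution \<open>h x\<close> at \<open>k = 0\<close>. \<close>

lemma fourier_series_converges_pointwise:
  assumes h: "continuous_on {-1..1} h" and x: "x \<in> {-1<..<1}"
    and D: "(h has_vector_derivative D) (at x)"
  shows "(\<lambda>n. \<Sum>k=-int n..int n. fourier_coeff h k * harmonic k x) \<longlonglongrightarrow> h x"
proof -
  define e where "e = harmonic 1"
  \<comment> \<open>The value at \<open>x\<close> is the limit of the quotient, as \<open>\<i> \<pi> e x\<close> is the derivative of \<open>e\<close> there.\<close>
  define q where "q t = (if t = x then D / (\<i> * of_real pi * e x) else (h t - h x) / (e t - e x))" for t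
  have e_nz: "e x \<noteq> 0"
    using norm_harmonic[of 1 x] by (auto simp: e_def simp del: norm_harmonic)
  have e_neq: "e t \<noteq> e x" if "t \<in> {-1..1}" "t \<noteq> x" for t
  proof
    assume "e t = e x"
    then have "exp (\<i> * of_real (pi * t)) = exp (\<i> * of_real (pi * x))"
      by (simp add: e_def harmonic_def cis_conv_exp)
    moreover have "\<bar>pi * t - pi * x\<bar> < 2 * pi"
    proof -
      have "\<bar>t - x\<bar> < 2" using that x by auto
      then have "pi * \<bar>t - x\<bar> < pi * 2" by simp
      then show ?thesis by (simp add: abs_mult flip: right_diff_distrib)
    qed
    ultimately have "\<i> * of_real (pi * t) = \<i> * of_real (pi * x)"
      by - (rule exp_complex_eqI, simp_all only: Im_i_times Re_complex_of_real)
    then show False using that by (simp add: complex_eq_iff)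
  qed
  have q_at_x: "(q \<longlongrightarrow> q x) (at x)"
  proof -
    have "((\<lambda>t. ((h t - h x) /\<^sub>R (t - x)) / ((e t - e x) /\<^sub>R (t - x)))
            \<longlongrightarrow> D / (\<i> * of_real (pi * of_int 1) * e x)) (at x)"
      using e_nz D unfolding e_def
      by (intro tendsto_divide has_vector_derivative_quotient_tendsto harmonic_has_vector_derivative) auto
    moreover have "eventually (\<lambda>t. ((h t - h x) /\<^sub>R (t - x)) / ((e t - e x) /\<^sub>R (t - x)) = q t) (at x)"
      unfolding eventually_at_filter
      by (rule always_eventually) (auto simp: q_def scaleR_conv_of_real)
    ultimately have "(q \<longlongrightarrow> D / (\<i> * of_real (pi * of_int 1) * e x)) (at x)"
      by (rule Lim_transform_eventually)
    then show ?thesis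
      by (simp add: q_def[of x])
  qed
  have q: "continuous_on {-1..1} q"
  proof (rule continuous_on_eq_continuous_within[THEN iffD2], intro ballI)
    fix t :: real assume t: "t \<in> {-1..1}"
    show "continuous (at t within {-1..1}) q"
    proof (cases "t = x")
      case True
      then show ?thesis
        using q_at_x continuous_at_imp_continuous_at_within isCont_def by blast
    next
      case False
      have "continuous (at t within {-1..1}) (\<lambda>s. (h s - h x) / (e s - e x))"
        using t False e_neq h continuous_on_harmonic[of "{-1..1}" 1]
        by (auto simp: continuous_on_eq_continuous_within e_def intro!: continuous_intros)
      moreover have "eventually (\<lambda>s. (h s - h x) / (e s - e x) = q s) (at t within {-1..1})"
        using eventually_neq_at_within[of x t "{-1..1}"]
        by eventually_elim (simp add: q_def)
      ultimately have "(q \<longlongrightarrow> (h t - h x) / (e t - e x)) (at t within {-1..1})"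
        unfolding continuous_within by (rule Lim_transform_eventually)
      then show ?thesis
        using False by (simp add: continuous_within q_def[of t])
    qed
  qed
  have h_eq: "h t = h x + q t * (e t - e x)" if "t \<in> {-1..1}" for t
    using e_neq[OF that] by (auto simp: q_def)
  note int = integrable_continuous_interval
  have coeff: "fourier_coeff h k = (if k = 0 then h x else 0) + fourier_coeff q (k - 1) - e x * fourier_coeff q k" for k
  proof -
    have shift: "e t * harmonic (- k) t = harmonic (- (k - 1)) t" for t
      by (simp add: e_def harmonic_mult)
    have "integral {-1..1} (\<lambda>t. h t * harmonic (- k) t) =
        integral {-1..1} (\<lambda>t. h x * harmonic (- k) t + q t * harmonic (- (k - 1)) t - e x * (q t * harmonic (- k) t))"
    proof (rule integral_cong)
      fix t :: real assume "t \<in> {-1..1}"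
      then have "h t * harmonic (- k) t = (h x + q t * (e t - e x)) * harmonic (- k) t"
        using h_eq by simp
      then show "h t * harmonic (- k) t =
          h x * harmonic (- k) t + q t * harmonic (- (k - 1)) t - e x * (q t * harmonic (- k) t)"
        unfolding shift[symmetric] by (simp only: ring_distribs mult_ac add_diff_eq)
    qed
    also have "\<dots> = integral {-1..1} (\<lambda>t. h x * harmonic (- k) t + q t * harmonic (- (k - 1)) t)
        - integral {-1..1} (\<lambda>t. e x * (q t * harmonic (- k) t))"
      by (intro integral_diff int continuous_intros q)
    also have "integral {-1..1} (\<lambda>t. h x * harmonic (- k) t + q t * harmonic (- (k - 1)) t)
        = integral {-1..1} (\<lambda>t. h x * harmonic (- k) t) + integral {-1..1} (\<lambda>t. q t * harmonic (- (k - 1)) t)"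
      by (intro integral_add int continuous_intros q)
    also have "integral {-1..1} (\<lambda>t. h x * harmonic (- k) t) = h x * integral {-1..1} (harmonic (- k))"
      by (rule integral_mult_right)
    also have "integral {-1..1} (\<lambda>t. e x * (q t * harmonic (- k) t)) =
        e x * integral {-1..1} (\<lambda>t. q t * harmonic (- k) t)"
      by (rule integral_mult_right)
    finally show ?thesis
      unfolding fourier_coeff_def
      by (simp add: integral_harmonic diff_divide_distrib add_divide_distrib del: minus_diff_eq)
  qed
  define T where "T k = fourier_coeff q k * harmonic (k + 1) x" for k
  have partial: "(\<Sum>k=-int n..int n. fourier_coeff h k * harmonic k x) = h x + T (- int n - 1) - T (int n)" for n
  proof -
    have step: "fourier_coeff h k * harmonic k x = (if k = 0 then h x else 0) + T (k - 1) - T k" for k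
    proof -
      have "harmonic (k + 1) x = e x * harmonic k x" by (simp add: e_def harmonic_mult add.commute)
      then show ?thesis by (simp add: coeff T_def algebra_simps)
    qed
    show ?thesis
    proof (induction n)
      case (Suc n)
      have "{-int (Suc n)..int (Suc n)} = insert (- int n - 1) (insert (int n + 1) {-int n..int n})"
        by auto
      then show ?case using Suc by (simp add: step add.commute)
    qed (use step[of 0] in simp)
  qed
  have T_0: "(\<lambda>n. T (\<sigma> n)) \<longlonglongrightarrow> 0" if "inj \<sigma>" for \<sigma> :: "nat \<Rightarrow> int"
  proof -
    have "(\<lambda>n. cmod (fourier_coeff q (\<sigma> n))) \<longlonglongrightarrow> 0"
      using fourier_coeff_tendsto_0[OF q that] by (rule tendsto_norm_zero)
    then have "(\<lambda>n. cmod (T (\<sigma> n))) \<longlonglongrightarrow> 0"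
      by (simp add: T_def norm_mult)
    then show ?thesis by (rule tendsto_norm_zero_cancel)
  qed
  have "(\<lambda>n. h x + T (- int n - 1) - T (int n)) \<longlonglongrightarrow> h x + 0 - 0"
    by (intro tendsto_intros T_0) (auto simp: inj_def)
  then show ?thesis by (simp add: partial)
qed

section \<open>Decay of the coefficients and the uniform error bound\<close>

lemma fourier_coeff_derivative:
  assumes g: "continuous_on {-1..1} g" and g': "continuous_on {-1..1} g'"
    and deriv: "\<And>x. x \<in> {-1<..<1} \<Longrightarrow> (g has_vector_derivative g' x) (at x)"
    and per: "g 1 = g (-1)"
  shows "fourier_coeff g' k = \<i> * of_real (pi * of_int k) * fourier_coeff g k"
proof -
  define a where "a = \<i> * complex_of_real (pi * of_int k)"
  have "((\<lambda>x. g x * (\<i> * of_real (pi * of_int (- k)) * harmonic (- k) x) + g' x * harmonic (- k) x) has_integral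
      g 1 * harmonic (- k) 1 - g (-1) * harmonic (- k) (-1)) {-1..1}"
    by (rule fundamental_theorem_of_calculus_interior)
       (simp, intro continuous_intros g, intro has_vector_derivative_mult harmonic_has_vector_derivative deriv)
  then have "((\<lambda>x. g' x * harmonic (- k) x - a * (g x * harmonic (- k) x)) has_integral 0) {-1..1}"
    by (simp add: per harmonic_periodic a_def algebra_simps)
  then have "0 = integral {-1..1} (\<lambda>x. g' x * harmonic (- k) x - a * (g x * harmonic (- k) x))"
    by (simp add: integral_unique)
  also have "\<dots> = integral {-1..1} (\<lambda>x. g' x * harmonic (- k) x) - a * integral {-1..1} (\<lambda>x. g x * harmonic (- k) x)"
    by (subst integral_diff; (intro integrable_continuous_interval continuous_intros g g')?) simp
  finally show ?thesis
    by (simp add: fourier_coeff_def a_def)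
qed

text \<open>
  The derivatives up to order \<open>m\<close> are carried along as a family of functions continuous up to the
  boundary, because integration by parts combines derivatives in the interior with values at the
  ends.
\<close>

definition derivative_chain :: "nat \<Rightarrow> real \<Rightarrow> real \<Rightarrow> (nat \<Rightarrow> real \<Rightarrow> 'a::real_normed_vector) \<Rightarrow> bool" where
  "derivative_chain m a b F \<longleftrightarrow>
     (\<forall>k\<le>m. continuous_on {a..b} (F k)) \<and>
     (\<forall>k<m. \<forall>x\<in>{a<..<b}. (F k has_vector_derivative F (Suc k) x) (at x))"

lemma fourier_coeff_iterated_derivative:
  assumes h: "derivative_chain m (-1) 1 h" and per: "\<And>k. k < m \<Longrightarrow> h k 1 = h k (-1)" and "j \<le> m"
  shows "fourier_coeff (h j) k = (\<i> * of_real (pi * of_int k)) ^ j * fourier_coeff (h 0) k"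
  using \<open>j \<le> m\<close>
proof (induction j)
  case (Suc j)
  have "fourier_coeff (h (Suc j)) k = \<i> * of_real (pi * of_int k) * fourier_coeff (h j) k"
    using h per Suc.prems by (intro fourier_coeff_derivative) (auto simp: derivative_chain_def)
  then show ?case using Suc by simp
qed simp

text \<open>
  Each summand is at most \<open>n\<close> to the power \<open>2 - 2m\<close> times \<open>1 / k\<^sup>2\<close>, and
  \<open>1 / k\<^sup>2 \<le> 1 / (k - 1) - 1 / k\<close> telescopes.
\<close>

lemma sum_inverse_even_powers_le:
  assumes "n \<ge> 1" "m \<ge> 1"
  shows "(\<Sum>k\<in>{n<..N}. 1 / real k ^ (2 * m)) \<le> 1 / real n ^ (2 * m - 1)"
proof -
  define a where "a = 1 / real n ^ (2 * m - 2)"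
  have pos: "a > 0" using assms by (simp add: a_def)
  have "(\<Sum>k\<in>{n<..N}. 1 / real k ^ (2 * m)) \<le> a * (1 / real n - 1 / real N)" if "N \<ge> n"
    using that
  proof (induction N rule: dec_induct)
    case (step N)
    have N: "real N \<ge> 1" using step assms by linarith
    have "1 / real (Suc N) ^ (2 * m) = 1 / real (Suc N) ^ (2 * m - 2) * (1 / real (Suc N) ^ 2)"
    proof -
      have "2 * m = (2 * m - 2) + 2" using assms by simp
      then have "real (Suc N) ^ (2 * m) = real (Suc N) ^ (2 * m - 2) * real (Suc N) ^ 2"
        by (metis power_add)
      then show ?thesis by simp
    qed
    also have "\<dots> \<le> a * (1 / real N - 1 / real (Suc N))"
    proof (rule mult_mono)
      show "1 / real (Suc N) ^ (2 * m - 2) \<le> a"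
        unfolding a_def using step assms by (intro divide_left_mono power_mono mult_pos_pos) auto
      have "1 / real N - 1 / real (Suc N) = 1 / (real N * real (Suc N))"
        using N by (simp add: field_simps)
      moreover have "1 / real (Suc N) ^ 2 \<le> 1 / (real N * real (Suc N))"
        using N by (intro divide_left_mono) (auto simp: power2_eq_square)
      ultimately show "1 / real (Suc N) ^ 2 \<le> 1 / real N - 1 / real (Suc N)" by simp
    qed (use pos in auto)
    finally have "1 / real (Suc N) ^ (2 * m) \<le> a * (1 / real N - 1 / real (Suc N))" .
    moreover have "{n<..Suc N} = insert (Suc N) {n<..N}" using step by auto
    ultimately show ?case using step.IH by (simp add: algebra_simps)
  qed simp
  moreover have "a * (1 / real n - 1 / real N) \<le> a * (1 / real n)"
    using pos by (intro mult_left_mono) auto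
  moreover have "a * (1 / real n) = 1 / real n ^ (2 * m - 1)"
  proof -
    have "2 * m - 1 = Suc (2 * m - 2)" using assms by simp
    then show ?thesis by (simp add: a_def)
  qed
  moreover have "{n<..N} = {}" if "\<not> N \<ge> n" using that by auto
  ultimately show ?thesis by (cases "N \<ge> n") (auto intro: order_trans)
qed

text \<open>
  The difference of two partial sums is a sum over \<open>n < \<bar>k\<bar> \<le> N\<close> of the coefficients of \<open>h m\<close>, divided
  by \<open>(\<i> \<pi> k)\<^sup>m\<close>. The Cauchy-Schwarz inequality separates the two factors: Bessel's inequality
  bounds the first one and \<open>sum_inverse_even_powers_le\<close> the second one, twice because of the two
  signs of \<open>k\<close>. As the bound is independent of \<open>N\<close>, it passes to the limit.
\<close>

lemma fourier_series_uniform_error: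
  assumes h: "derivative_chain m (-1) 1 h" and per: "\<And>k. k < m \<Longrightarrow> h k 1 = h k (-1)"
    and m: "m \<ge> 1" and n: "n \<ge> 1" and x: "x \<in> {-1<..<1}"
  shows "(cmod (h 0 x - (\<Sum>k=-int n..int n. fourier_coeff (h 0) k * harmonic k x)))\<^sup>2
           \<le> integral {-1..1} (\<lambda>x. (cmod (h m x))\<^sup>2) / real n ^ (2 * m - 1)"
proof -
  define c where "c = fourier_coeff (h 0)"
  define d where "d = fourier_coeff (h m)"
  define S where "S N = (\<Sum>k=-int N..int N. c k * harmonic k x)" for N
  define I where "I = integral {-1..1} (\<lambda>x. (cmod (h m x))\<^sup>2)"
  have cont: "continuous_on {-1..1} (h k)" if "k \<le> m" for k
    using h that by (auto simp: derivative_chain_def)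
  have "S \<longlonglongrightarrow> h 0 x"
    unfolding S_def c_def using h m x
    by (intro fourier_series_converges_pointwise[where D = "h 1 x"] cont) (auto simp: derivative_chain_def)
  then have lim: "(\<lambda>N. (cmod (S N - S n))\<^sup>2) \<longlonglongrightarrow> (cmod (h 0 x - S n))\<^sup>2"
    by (intro tendsto_intros)
  have "(cmod (S N - S n))\<^sup>2 \<le> I / real n ^ (2 * m - 1)" if "N \<ge> n" for N
  proof -
    define A where "A = {-int N..int N} - {-int n..int n}"
    have A: "finite A" by (simp add: A_def)
    have A_split: "A = int ` {n<..N} \<union> (\<lambda>k. - int k) ` {n<..N}" (is "_ = ?P \<union> ?M")
    proof (intro set_eqI iffI)
      fix k
      assume "k \<in> A"
      then have "nat \<bar>k\<bar> \<in> {n<..N}" by (auto simp: A_def)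
      moreover have "k = int (nat \<bar>k\<bar>) \<or> k = - int (nat \<bar>k\<bar>)" by auto
      ultimately show "k \<in> ?P \<union> ?M" by blast
    qed (auto simp: A_def)
    have c_bound: "cmod (c k) \<le> cmod (d k) * (1 / real_of_int \<bar>k\<bar> ^ m)" if "k \<in> A" for k
    proof -
      have k: "real_of_int \<bar>k\<bar> \<ge> 1" using that by (auto simp: A_def)
      have "cmod (d k) = (pi * real_of_int \<bar>k\<bar>) ^ m * cmod (c k)"
        using fourier_coeff_iterated_derivative[OF h per order_refl, of k] unfolding c_def d_def
        by (simp add: norm_mult norm_power abs_mult)
      moreover have "real_of_int \<bar>k\<bar> ^ m * cmod (c k) \<le> (pi * real_of_int \<bar>k\<bar>) ^ m * cmod (c k)"
        using k pi_ge_two by (intro mult_right_mono power_mono) (auto simp: mult_le_cancel_right1)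
      ultimately have "real_of_int \<bar>k\<bar> ^ m * cmod (c k) \<le> cmod (d k)"
        by simp
      moreover have "real_of_int \<bar>k\<bar> ^ m > 0"
        using k by (intro zero_less_power) simp
      ultimately show ?thesis
        by (simp add: pos_le_divide_eq mult.commute del: of_int_abs zero_less_power_abs_iff)
    qed
    have "S N - S n = (\<Sum>k\<in>A. c k * harmonic k x)"
      unfolding S_def A_def using that by (subst sum_diff) auto
    then have "cmod (S N - S n) \<le> (\<Sum>k\<in>A. cmod (d k) * (1 / real_of_int \<bar>k\<bar> ^ m))"
      using c_bound by (auto intro!: sum_norm_le simp: norm_mult)
    then have "(cmod (S N - S n))\<^sup>2 \<le> (\<Sum>k\<in>A. cmod (d k) * (1 / real_of_int \<bar>k\<bar> ^ m))\<^sup>2"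
      by (intro power_mono) auto
    also have "\<dots> \<le> (\<Sum>k\<in>A. (cmod (d k))\<^sup>2) * (\<Sum>k\<in>A. (1 / real_of_int \<bar>k\<bar> ^ m)\<^sup>2)"
      by (rule Cauchy_Schwarz_ineq_sum)
    also have "\<dots> \<le> I / 2 * (2 / real n ^ (2 * m - 1))"
    proof (rule mult_mono)
      show "(\<Sum>k\<in>A. (cmod (d k))\<^sup>2) \<le> I / 2"
        unfolding d_def I_def by (intro bessel_inequality cont A) simp
      have "(\<Sum>k\<in>A. (1 / real_of_int \<bar>k\<bar> ^ m)\<^sup>2) = (\<Sum>k\<in>A. 1 / real_of_int \<bar>k\<bar> ^ (2 * m))"
        by (simp add: power_divide power_mult mult.commute flip: power_mult)
      also have "\<dots> = (\<Sum>k\<in>?P. 1 / real_of_int \<bar>k\<bar> ^ (2 * m)) + (\<Sum>k\<in>?M. 1 / real_of_int \<bar>k\<bar> ^ (2 * m))"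
        unfolding A_split by (rule sum.union_disjoint) auto
      also have "\<dots> = 2 * (\<Sum>k\<in>{n<..N}. 1 / real k ^ (2 * m))"
        by (simp add: sum.reindex inj_on_def)
      also have "\<dots> \<le> 2 / real n ^ (2 * m - 1)"
        using sum_inverse_even_powers_le[OF n m, of N] by simp
      finally show "(\<Sum>k\<in>A. (1 / real_of_int \<bar>k\<bar> ^ m)\<^sup>2) \<le> 2 / real n ^ (2 * m - 1)" .
      show "0 \<le> I / 2"
        unfolding I_def by (simp, intro integral_nonneg integrable_continuous_interval continuous_intros cont) auto
    qed (auto intro: sum_nonneg)
    finally show ?thesis by simp
  qed
  then have "eventually (\<lambda>N. (cmod (S N - S n))\<^sup>2 \<le> I / real n ^ (2 * m - 1)) sequentially"
    by (rule eventually_mono[OF eventually_ge_at_top[of n]])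
  then have "(cmod (h 0 x - S n))\<^sup>2 \<le> I / real n ^ (2 * m - 1)"
    by (intro tendsto_upperbound[OF lim]) auto
  then show ?thesis by (simp add: S_def c_def I_def)
qed

section \<open>Removing the boundary jumps\<close>

lemma C_cl_derivative_chain:
  assumes f: "f \<in> C_cl m a b" and ab: "a < b"
  obtains F where "derivative_chain m a b F" "\<And>x. x \<in> {a<..<b} \<Longrightarrow> F 0 x = f x"
proof -
  have "\<exists>l. k \<le> m \<longrightarrow> ((deriv ^^ k) f \<longlongrightarrow> l) (at_right a)" for k
    using f by (auto simp: C_cl_def)
  then obtain l where l: "\<And>k. k \<le> m \<Longrightarrow> ((deriv ^^ k) f \<longlongrightarrow> l k) (at_right a)"
    by metis
  have "\<exists>r. k \<le> m \<longrightarrow> ((deriv ^^ k) f \<longlongrightarrow> r) (at_left b)" for k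
    using f by (auto simp: C_cl_def)
  then obtain r where r: "\<And>k. k \<le> m \<Longrightarrow> ((deriv ^^ k) f \<longlongrightarrow> r k) (at_left b)"
    by metis
  define F where "F k x = (if x \<le> a then l k else if x \<ge> b then r k else (deriv ^^ k) f x)" for k x
  have F_eq: "F k x = (deriv ^^ k) f x" if "x \<in> {a<..<b}" for k x
    using that by (simp add: F_def)
  have "continuous_on {a..b} (F k)" if k: "k \<le> m" for k
  proof (rule continuous_on_IccI)
    have "eventually (\<lambda>x. F k x = (deriv ^^ k) f x) (at_right a)"
      using eventually_at_right_real[OF ab] by eventually_elim (rule F_eq)
    then show "(F k \<longlongrightarrow> F k a) (at_right a)"
      using l[OF k] by (simp add: F_def tendsto_cong)
    have "eventually (\<lambda>x. F k x = (deriv ^^ k) f x) (at_left b)"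
      using eventually_at_left_real[OF ab] by eventually_elim (rule F_eq)
    then show "(F k \<longlongrightarrow> F k b) (at_left b)"
      using r[OF k] ab by (simp add: F_def tendsto_cong)
    fix x assume x: "a < x" "x < b"
    have "continuous_on {a<..<b} (F k)"
      using f k F_eq by (subst continuous_on_cong[OF refl]) (auto simp: C_cl_def)
    then show "F k \<midarrow>x\<rightarrow> F k x"
      using x by (auto simp: continuous_on_eq_continuous_at isCont_def)
  qed (rule ab)
  moreover have "(F k has_vector_derivative F (Suc k) x) (at x)" if "k < m" "x \<in> {a<..<b}" for k x
  proof -
    have "(deriv ^^ k) f differentiable at x"
      using f that by (auto simp: C_cl_def differentiable_on_eq_differentiable_at)
    then have "((deriv ^^ k) f has_field_derivative (deriv ^^ Suc k) f x) (at x)"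
      by (simp add: DERIV_deriv_iff_real_differentiable)
    then have "((deriv ^^ k) f has_vector_derivative F (Suc k) x) (at x)"
      using F_eq[OF that(2)] by (simp add: has_real_derivative_iff_has_vector_derivative)
    then show ?thesis
      using that(2) by (rule has_vector_derivative_transform_within_open[OF _ open_greaterThanLessThan]) (simp add: F_eq)
  qed
  ultimately show ?thesis
    using F_eq[of _ 0] by (intro that[of F]) (auto simp: derivative_chain_def)
qed

text \<open>
  Elimination of one node: a solution for the smaller set and the right-hand side
  \<open>b (Suc k) - w * b k\<close>, divided by \<open>z - w\<close>, gives the weights at the old nodes, and the weight at the
  new node \<open>w\<close> is determined by the equation for \<open>k = 0\<close>. The other equations follow recursively.
\<close>

lemma vandermonde_solvable:
  fixes A :: "'a::field set"
  assumes "finite A"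
  shows "\<exists>e. \<forall>k<card A. (\<Sum>z\<in>A. e z * z ^ k) = b k"
  using assms
proof (induction A arbitrary: b rule: finite_induct)
  case (insert w A)
  obtain d where d: "\<And>k. k < card A \<Longrightarrow> (\<Sum>z\<in>A. d z * z ^ k) = b (Suc k) - w * b k"
    using insert.IH[of "\<lambda>k. b (Suc k) - w * b k"] by blast
  define u where "u z = d z / (z - w)" for z
  define e where "e = u(w := b 0 - (\<Sum>z\<in>A. u z))"
  have split_sum: "(\<Sum>z\<in>insert w A. e z * z ^ k) = e w * w ^ k + (\<Sum>z\<in>A. u z * z ^ k)" for k
    using insert.hyps by (auto simp: e_def intro!: sum.cong)
  have "(\<Sum>z\<in>insert w A. e z * z ^ k) = b k" if "k \<le> card A" for k
    using that
  proof (induction k)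
    case 0
    then show ?case unfolding split_sum by (simp add: e_def)
  next
    case (Suc k)
    have "(\<Sum>z\<in>A. u z * z ^ Suc k) - w * (\<Sum>z\<in>A. u z * z ^ k) = (\<Sum>z\<in>A. u z * (z - w) * z ^ k)"
      by (simp add: sum_distrib_left algebra_simps flip: sum_subtractf)
    also have "\<dots> = (\<Sum>z\<in>A. d z * z ^ k)"
      using insert.hyps by (intro sum.cong) (auto simp: u_def)
    also have "\<dots> = b (Suc k) - w * b k"
      using Suc.prems by (intro d) simp
    finally have "(\<Sum>z\<in>A. u z * z ^ Suc k) = b (Suc k) - w * (b k - (\<Sum>z\<in>A. u z * z ^ k))"
      by (simp add: algebra_simps)
    also have "b k - (\<Sum>z\<in>A. u z * z ^ k) = e w * w ^ k"
      using Suc.IH Suc.prems unfolding split_sum by (simp add: algebra_simps)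
    finally show ?case
      unfolding split_sum by simp
  qed
  then show ?case
    using insert.hyps by (intro exI[of _ e]) auto
qed simp

text \<open>
  The index \<open>k\<close> is the order of differentiation. The frequencies \<open>1 / j\<close> are distinct and lie in
  the interval \<open>(0, \<pi>)\<close>, on which the difference \<open>2 \<i> sin \<omega>\<close> of the values of \<open>exp (\<i> \<omega> x)\<close> at the
  two ends is nonzero.
\<close>

definition boundary_exponentials :: "nat \<Rightarrow> (nat \<Rightarrow> complex) \<Rightarrow> nat \<Rightarrow> real \<Rightarrow> complex" where
  "boundary_exponentials m e k x =
     (\<Sum>j=1..m. e j * (\<i> * of_real (1 / real j)) ^ k * exp (\<i> * of_real (1 / real j * x)))"

lemma boundary_exponentials_has_vector_derivative:
  "(boundary_exponentials m e k has_vector_derivative boundary_exponentials m e (Suc k) x) (at x)"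
proof -
  have "((\<lambda>x. \<Sum>j=1..m. e j * (\<i> * of_real (1 / real j)) ^ k * exp (\<i> * of_real (1 / real j * x)))
      has_vector_derivative
        (\<Sum>j=1..m. e j * (\<i> * of_real (1 / real j)) ^ k *
          (\<i> * of_real (1 / real j) * exp (\<i> * of_real (1 / real j * x))))) (at x)"
    by (intro has_vector_derivative_sum has_vector_derivative_mult_right exp_has_vector_derivative)
  then show ?thesis
    unfolding boundary_exponentials_def by (simp only: power_Suc mult_ac)
qed

text \<open>
  After division by the nonzero end point differences \<open>s j\<close> of the exponentials, the amplitudes solve
  a Vandermonde system with nodes \<open>\<i> / j\<close>.
\<close>

lemma boundary_exponentials_attain_jumps:
  fixes b :: "nat \<Rightarrow> complex"
  obtains e where "\<And>k. k < m \<Longrightarrow>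
    boundary_exponentials m e k 1 - boundary_exponentials m e k (-1) = b k"
proof -
  define z where "z j = \<i> * complex_of_real (1 / real j)" for j
  define s where "s j = exp (\<i> * complex_of_real (1 / real j * 1))
    - exp (\<i> * complex_of_real (1 / real j * (-1)))" for j
  have inj: "inj_on z {1..m}"
    by (auto simp: z_def inj_on_def)
  have s: "s j \<noteq> 0" if "j \<in> {1..m}" for j
  proof
    assume s_0: "s j = 0"
    have "\<i> * complex_of_real (1 / real j * 1) = \<i> * complex_of_real (1 / real j * (-1))"
    proof (rule exp_complex_eqI[rotated])
      have "1 / real j \<le> 1" using that by simp
      then show "\<bar>Im (\<i> * complex_of_real (1 / real j * 1))
          - Im (\<i> * complex_of_real (1 / real j * (-1)))\<bar> < 2 * pi"
        using pi_ge_two by simp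
    qed (use s_0 in \<open>simp add: s_def\<close>)
    then show False using that by (simp add: complex_eq_iff)
  qed
  have card: "card (z ` {1..m}) = m"
    using inj by (simp add: card_image)
  obtain d where d: "\<And>k. k < m \<Longrightarrow> (\<Sum>w\<in>z ` {1..m}. d w * w ^ k) = b k"
    using vandermonde_solvable[of "z ` {1..m}" b] unfolding card by auto
  show ?thesis
  proof (rule that[of "\<lambda>j. d (z j) / s j"])
    fix k assume "k < m"
    have "boundary_exponentials m (\<lambda>j. d (z j) / s j) k 1
        - boundary_exponentials m (\<lambda>j. d (z j) / s j) k (-1)
      = (\<Sum>j=1..m. d (z j) / s j * z j ^ k * s j)"
      unfolding boundary_exponentials_def s_def z_def
      by (simp only: sum_subtractf[symmetric] right_diff_distrib)
    also have "\<dots> = (\<Sum>j=1..m. d (z j) * z j ^ k)"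
      using s by (intro sum.cong) auto
    also have "\<dots> = b k"
      using d[OF \<open>k < m\<close>] inj by (simp add: sum.reindex)
    finally show "boundary_exponentials m (\<lambda>j. d (z j) / s j) k 1
        - boundary_exponentials m (\<lambda>j. d (z j) / s j) k (-1) = b k" .
  qed
qed

lemma C_cl_periodic_decomposition:
  assumes f: "f \<in> C_cl m (-1) 1"
  obtains e h where "derivative_chain m (-1) 1 h" "\<And>k. k < m \<Longrightarrow> h k 1 = h k (-1)"
    "\<And>x. x \<in> {-1<..<1} \<Longrightarrow> complex_of_real (f x) = boundary_exponentials m e 0 x + h 0 x"
proof -
  obtain F where F: "derivative_chain m (-1) 1 F" and F_0: "\<And>x. x \<in> {-1<..<1} \<Longrightarrow> F 0 x = f x"
    using C_cl_derivative_chain[OF f] by auto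
  obtain e where e: "\<And>k. k < m \<Longrightarrow> boundary_exponentials m e k 1 - boundary_exponentials m e k (-1)
      = complex_of_real (F k 1) - complex_of_real (F k (-1))"
    using boundary_exponentials_attain_jumps[of m "\<lambda>k. complex_of_real (F k 1) - complex_of_real (F k (-1))"]
    by blast
  define h where "h k x = complex_of_real (F k x) - boundary_exponentials m e k x" for k x
  have "derivative_chain m (-1) 1 h"
    unfolding derivative_chain_def
  proof (intro conjI allI impI ballI)
    show "continuous_on {-1..1} (h k)" if "k \<le> m" for k
      using F that unfolding h_def boundary_exponentials_def derivative_chain_def
      by (intro continuous_intros) auto
    show "(h k has_vector_derivative h (Suc k) x) (at x)" if "k < m" "x \<in> {-1<..<1}" for k x
      using F that unfolding h_def derivative_chain_def
      by (intro has_vector_derivative_diff boundary_exponentials_has_vector_derivative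
          has_vector_derivative_of_real) (simp_all add: has_real_derivative_iff_has_vector_derivative)
  qed
  moreover have "h k 1 = h k (-1)" if "k < m" for k
    using e[OF that] by (simp add: h_def algebra_simps)
  moreover have "complex_of_real (f x) = boundary_exponentials m e 0 x + h 0 x" if "x \<in> {-1<..<1}" for x
    using F_0[OF that] by (simp add: h_def)
  ultimately show ?thesis by (rule that)
qed

section \<open>The exponential sum\<close>

text \<open>
  The first \<open>m\<close> indices belong to the boundary exponentials, the following \<open>2n + 1\<close> to the harmonics
  from \<open>-n\<close> to \<open>n\<close>. Any further amplitude is zero.
\<close>

definition frequency :: "nat \<Rightarrow> nat \<Rightarrow> nat \<Rightarrow> real" where
  "frequency m n k = (if k \<le> m then 1 / real k else pi * of_int (int k - int m - 1 - int n))"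

definition coefficient :: "nat \<Rightarrow> nat \<Rightarrow> (nat \<Rightarrow> complex) \<Rightarrow> (int \<Rightarrow> complex) \<Rightarrow> nat \<Rightarrow> complex" where
  "coefficient m n e c k =
     (if k \<le> m then e k else if k \<le> m + 2 * n + 1 then c (int k - int m - 1 - int n) else 0)"

lemma exp_sum_frequency:
  assumes "m + 2 * n + 1 \<le> N"
  shows "exp_sum N (coefficient m n e c) (frequency m n) x =
    boundary_exponentials m e 0 x + (\<Sum>k=-int n..int n. c k * harmonic k x)"
proof -
  let ?t = "\<lambda>k. coefficient m n e c k * exp (\<i> * complex_of_real (frequency m n k * x))"
  have "exp_sum N (coefficient m n e c) (frequency m n) x = (\<Sum>k\<in>{1..m} \<union> {m+1..m+2*n+1}. ?t k)"
    unfolding exp_sum_def using assms by (intro sum.mono_neutral_right) (auto simp: coefficient_def)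
  also have "\<dots> = (\<Sum>k=1..m. ?t k) + (\<Sum>k=m+1..m+2*n+1. ?t k)"
    by (rule sum.union_disjoint) auto
  also have "(\<Sum>k=1..m. ?t k) = boundary_exponentials m e 0 x"
    unfolding boundary_exponentials_def by (intro sum.cong) (auto simp: coefficient_def frequency_def)
  also have "(\<Sum>k=m+1..m+2*n+1. ?t k) = (\<Sum>k=-int n..int n. c k * harmonic k x)"
    by (rule sum.reindex_bij_witness[where i = "\<lambda>k. nat (k + int m + 1 + int n)"
          and j = "\<lambda>k. int k - int m - 1 - int n"])
       (auto simp: coefficient_def frequency_def harmonic_def cis_conv_exp)
  finally show ?thesis .
qed

lemma L2_norm_on_le_sup:
  assumes f: "f \<in> C_cl m a b" and ab: "a < b" and F: "continuous_on {a..b} F"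
    and bound: "\<And>x. x \<in> {a<..<b} \<Longrightarrow> (cmod (complex_of_real (f x) - F x))\<^sup>2 \<le> B"
  shows "L2_norm_on a b (\<lambda>x. complex_of_real (f x) - F x) \<le> sqrt (B * (b - a))"
proof -
  have "(LINT x:{a<..<b}|lborel. (cmod (complex_of_real (f x) - F x))\<^sup>2) \<le> (LINT x:{a<..<b}|lborel. B)"
    using ab by (intro set_integral_mono C_cl_diff_square_integrable[OF f ab F] bound)
      (auto simp: set_integrable_def)
  also have "\<dots> = B * (b - a)"
    using ab by (simp add: set_lebesgue_integral_def)
  finally show ?thesis
    by (simp add: L2_norm_on_def)
qed


lemma sqrt_inverse_odd_power_le:
  assumes m: "m \<ge> 1" and W: "W \<ge> 1" and n: "real W \<le> 2 * real n"
  shows "sqrt (1 / real n ^ (2 * m - 1)) \<le> 2 powr (real m - 1 / 2) * real W powr (- real m + 1 / 2)"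
proof -
  define j where "j = 2 * m - 1"
  define a where "a = - real m + 1 / 2"
  have j: "real j = 2 * real m - 1" using m by (simp add: j_def of_nat_diff)
  have n_pos: "real n > 0" using W n by simp
  have n_pow: "1 / real n ^ j = real n powr (- real j)"
    using n_pos by (simp only: powr_minus powr_realpow inverse_eq_divide)
  have "sqrt (1 / real n ^ j) = (real n powr (- real j)) powr (1 / 2)"
    unfolding n_pow by (subst powr_half_sqrt) auto
  also have "(real n powr (- real j)) powr (1 / 2) = real n powr a"
    unfolding powr_powr a_def j by (rule arg_cong[where f = "\<lambda>u. real n powr u"]) (simp add: field_simps)
  also have "\<dots> \<le> (real W / 2) powr a"
    using m W n by (intro powr_mono2') (auto simp: a_def)
  also have "\<dots> = 2 powr (- a) * real W powr a"
    by (subst powr_divide) (simp_all add: powr_minus field_simps)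
  finally show ?thesis by (simp add: a_def j_def)
qed

theorem theorem2:
  fixes m :: nat
  assumes "m \<ge> 1"
  shows "\<exists>\<omega> :: nat \<Rightarrow> nat \<Rightarrow> real. \<forall>f \<in> C_cl m (-1) 1.
    \<exists>C D :: real. C > 0 \<and>
      (\<forall>W \<ge> 1. \<exists>c :: nat \<Rightarrow> complex.
         L2_norm_on (-1) 1
           (\<lambda>x. complex_of_real (f x) - exp_sum (W + 2 * (m + 1)) c (\<omega> W) x)
           \<le> C * real W powr (- real m + 1 / 2) \<and>
         (\<forall>k \<in> {1..W + 2 * (m + 1)}. cmod (c k) \<le> D))"
proof (rule exI[of _ "\<lambda>W. frequency m ((W + 1) div 2)"], rule ballI)
  fix f assume f: "f \<in> C_cl m (-1) 1"
  obtain e h where h: "derivative_chain m (-1) 1 h" and per: "\<And>k. k < m \<Longrightarrow> h k 1 = h k (-1)"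
    and f_eq: "\<And>x. x \<in> {-1<..<1} \<Longrightarrow> complex_of_real (f x) = boundary_exponentials m e 0 x + h 0 x"
    by (rule C_cl_periodic_decomposition[OF f]) (rule that, assumption+)
  have h_0: "continuous_on {-1..1} (h 0)" and h_m: "continuous_on {-1..1} (h m)"
    using h by (auto simp: derivative_chain_def)
  define I where "I = integral {-1..1} (\<lambda>x. (cmod (h m x))\<^sup>2)"
  have I: "I \<ge> 0"
    unfolding I_def by (intro integral_nonneg integrable_continuous_interval continuous_intros h_m) auto
  have "bounded (h 0 ` {-1..1})"
    using h_0 by (intro compact_imp_bounded compact_continuous_image) auto
  then obtain M where M: "\<And>x. x \<in> {-1..1} \<Longrightarrow> cmod (h 0 x) \<le> M"
    unfolding bounded_iff by blast
  have M_nonneg: "M \<ge> 0"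
    using M[of 0] norm_ge_zero[of "h 0 0"] by (simp del: norm_ge_zero)
  define C where "C = sqrt (2 * I) * 2 powr (real m - 1 / 2) + 1"
  define D where "D = M + (\<Sum>j=1..m. cmod (e j))"
  \<comment> \<open>The choice \<open>n = (W + 1) div 2\<close> gives \<open>n \<ge> W / 2\<close> while the \<open>2n + 1 \<le> W + 2\<close> harmonics and the \<open>m\<close>
    boundary exponentials fit into \<open>W + 2 * (m + 1)\<close> terms. The summand 1 in \<open>C\<close> only makes it positive.\<close>
  have "\<exists>c. L2_norm_on (-1) 1
        (\<lambda>x. complex_of_real (f x) - exp_sum (W + 2 * (m + 1)) c (frequency m ((W + 1) div 2)) x)
        \<le> C * real W powr (- real m + 1 / 2) \<and>
      (\<forall>k \<in> {1..W + 2 * (m + 1)}. cmod (c k) \<le> D)" if W: "W \<ge> 1" for W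
  proof -
    define n where "n = (W + 1) div 2"
    define N where "N = W + 2 * (m + 1)"
    define c where "c = coefficient m n e (fourier_coeff (h 0))"
    have n: "n \<ge> 1" "real W \<le> 2 * real n" and nN: "m + 2 * n + 1 \<le> N"
      using W by (auto simp: n_def N_def)
    have error: "(cmod (complex_of_real (f x) - exp_sum N c (frequency m n) x))\<^sup>2
        \<le> I / real n ^ (2 * m - 1)" if "x \<in> {-1<..<1}" for x
      using fourier_series_uniform_error[OF h per assms n(1) that] f_eq[OF that]
      unfolding c_def exp_sum_frequency[OF nN] I_def by simp
    have "L2_norm_on (-1) 1 (\<lambda>x. complex_of_real (f x) - exp_sum N c (frequency m n) x)
        \<le> sqrt (I / real n ^ (2 * m - 1) * (1 - (-1)))"
      by (rule L2_norm_on_le_sup[OF f _ continuous_on_exp_sum error]) auto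
    also have "\<dots> = sqrt (2 * I) * sqrt (1 / real n ^ (2 * m - 1))"
      by (simp flip: real_sqrt_mult)
    also have "\<dots> \<le> sqrt (2 * I) * (2 powr (real m - 1 / 2) * real W powr (- real m + 1 / 2))"
      using I by (intro mult_left_mono sqrt_inverse_odd_power_le[OF assms W n(2)]) auto
    also have "\<dots> \<le> C * real W powr (- real m + 1 / 2)"
      by (simp add: C_def algebra_simps)
    finally have "L2_norm_on (-1) 1 (\<lambda>x. complex_of_real (f x) - exp_sum N c (frequency m n) x)
        \<le> C * real W powr (- real m + 1 / 2)" .
    moreover have "cmod (c k) \<le> D" if k: "k \<in> {1..N}" for k
    proof -
      have "cmod (fourier_coeff (h 0) l) \<le> D" for l
        unfolding D_def using fourier_coeff_bound[OF h_0 M, of l]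
        by (rule order_trans[OF _ add_increasing2[OF sum_nonneg]]) auto
      moreover have "D \<ge> 0"
        unfolding D_def using M_nonneg by (intro add_nonneg_nonneg sum_nonneg) auto
      moreover have "cmod (e k) \<le> D" if "k \<le> m"
        unfolding D_def using k that M_nonneg
        by (intro add_increasing member_le_sum) auto
      ultimately show ?thesis
        by (auto simp: c_def coefficient_def)
    qed
    ultimately show ?thesis
      unfolding N_def n_def by (intro exI[of _ c] conjI ballI)
  qed
  moreover have "C > 0"
    unfolding C_def using I by (intro add_nonneg_pos mult_nonneg_nonneg) simp_all
  ultimately show "\<exists>C D. C > 0 \<and> (\<forall>W \<ge> 1. \<exists>c. L2_norm_on (-1) 1
        (\<lambda>x. complex_of_real (f x) - exp_sum (W + 2 * (m + 1)) c (frequency m ((W + 1) div 2)) x)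
        \<le> C * real W powr (- real m + 1 / 2) \<and>
      (\<forall>k \<in> {1..W + 2 * (m + 1)}. cmod (c k) \<le> D))"
    by (intro exI[of _ C] exI[of _ D] conjI allI impI)
qed

end
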